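(* Let $a,b$ be nonzero real numbers with $ab\neq -4$, let $\alpha,\beta$ be the roots of $x^2-abx-ab=0$, and let $\widetilde{Q}_n$ be the $n$th bi-periodic dual Fibonacci quaternion. With the quaternions $\alpha^{\ast},\beta^{\ast},\alpha^{\ast\ast},\beta^{\ast\ast}$ defined in the context, for every integer $m\ge 1$: (i) (odd indices) $$\widetilde{Q}_{2m-1}\widetilde{Q}_{2m+3}-\widetilde{Q}_{2m+1}^2=-\left\{\frac{((ab)^2-\beta^4)\alpha^{\ast\ast}\beta^{\ast\ast}+((ab)^2-\alpha^4)\beta^{\ast\ast}\alpha^{\ast\ast}}{(ab)(\alpha-\beta)^2}\right\}$$ $$-\varepsilon\left\{\frac{\alpha\left[((ab)^2-\beta^4)\alpha^{\ast}\beta^{\ast\ast}+((ab)^2-\alpha^4)\beta^{\ast\ast}\alpha^{\ast}\right]}{(ab)^2(\alpha-\beta)^2}+\frac{\beta\left[((ab)^2-\alpha^4)\beta^{\ast}\alpha^{\ast\ast}+((ab)^2-\beta^4)\alpha^{\ast\ast}\beta^{\ast}\right]}{(ab)^2(\alpha-\beta)^2}\right\};$$ (ii) (even indices) $$\widetilde{Q}_{2m-2}\widetilde{Q}_{2m+2}-\widetilde{Q}_{2m}^2=\frac{((ab)^2-\beta^4)\alpha^{\ast}\beta^{\ast}+((ab)^2-\alpha^4)\beta^{\ast}\alpha^{\ast}}{(ab)^2(\alpha-\beta)^2}$$ $$+\varepsilon\left\{\frac{(\alpha^{\ast\ast}\beta^{\ast}\alpha+\alpha^{\ast}\beta^{\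ast\ast}\beta)((ab)^2-\beta^4)}{(ab)^2(\alpha-\beta)^2}+\frac{(\beta^{\ast}\alpha^{\ast\ast}\alpha+\beta^{\ast\ast}\alpha^{\ast}\beta)((ab)^2-\alpha^4)}{(ab)^2(\alpha-\beta)^2}\right\}.$$
   Context: For nonzero real numbers $a,b$, the bi-periodic Fibonacci numbers are defined by $F_0=0$, $F_1=1$ and, for $n\ge 2$, $F_n=aF_{n-1}+F_{n-2}$ if $n$ is even, $F_n=bF_{n-1}+F_{n-2}$ if $n$ is odd. The bi-periodic Fibonacci quaternions are $Q_n=F_n+F_{n+1}i+F_{n+2}j+F_{n+3}k$, where $i,j,k$ are the quaternion units: $i^2=j^2=k^2=ijk=-1$. The dual unit $\varepsilon\neq 0$ satisfies $\varepsilon^2=0$ and commutes with quaternions. The bi-periodic dual Fibonacci quaternions are $\widetilde{Q}_n=Q_n+\varepsilon Q_{n+1}$, and multiplication of dual quaternions is $(p+\varepsilon p')(q+\varepsilon q')=pq+\varepsilon(p'q+pq')$ with the (noncommutative) quaternion product. The numbers $\alpha,\beta$ are the two roots of $x^2-abx-ab=0$, so $\alpha+\beta=ab$ and $\alpha\beta=-ab$; if they are non-real, all expressions are read in quaternions with complex coefficients (scalars being central and distinct from the unit $i$). Define $$\alpha^{\ast}=a+\alpha i+\frac{a}{ab}\alpha^2 j+\frac{1}{ab}\alpha^3 k,\qquad \beta^{\ast}=a+\beta i+\frac{a}{ab}\beta^2 j+\frac{1}{ab}\beta^3 k,$$ $$\alpha^{\ast\ast}=1+\frac{a}{ab}\alpha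 i+\frac{1}{ab}\alpha^2 j+\frac{a}{(ab)^2}\alpha^3 k,\qquad \beta^{\ast\ast}=1+\frac{a}{ab}\beta i+\frac{1}{ab}\beta^2 j+\frac{a}{(ab)^2}\beta^3 k.$$ *)

theory Defs
  imports Complex_Main
begin

section \<open>Quaternions over a commutative ring\<close>

text \<open>The scalars are kept generic because the statement lives in the real quaternions on one side
  and in the quaternions with complex coefficients on the other. In the latter the imaginary unit
  of the scalars is central, and distinct from the quaternion unit \<open>qi\<close>.\<close>

datatype 'a quat = Quat (qre: 'a) (qim1: 'a) (qim2: 'a) (qim3: 'a)

instantiation quat :: (comm_ring_1) ring_1
begin

definition "0 = Quat 0 0 0 0"

definition "1 = Quat 1 0 0 0"

definition "x + y = Quat (qre x + qre y) (qim1 x + qim1 y) (qim2 x + qim2 y) (qim3 x + qim3 y)"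

definition "- x = Quat (- qre x) (- qim1 x) (- qim2 x) (- qim3 x)"

definition "x - y = Quat (qre x - qre y) (qim1 x - qim1 y) (qim2 x - qim2 y) (qim3 x - qim3 y)"

definition "x * y = Quat
  (qre x * qre y - qim1 x * qim1 y - qim2 x * qim2 y - qim3 x * qim3 y)
  (qre x * qim1 y + qim1 x * qre y + qim2 x * qim3 y - qim3 x * qim2 y)
  (qre x * qim2 y - qim1 x * qim3 y + qim2 x * qre y + qim3 x * qim1 y)
  (qre x * qim3 y + qim1 x * qim2 y - qim2 x * qim1 y + qim3 x * qre y)"

lemmas quat_ops = zero_quat_def one_quat_def plus_quat_def uminus_quat_def minus_quat_def
  times_quat_def

instance
  by standard (simp_all add: quat_ops algebra_simps)

end

definition qi :: "'a::comm_ring_1 quat" where "qi = Quat 0 1 0 0"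
definition qj :: "'a::comm_ring_1 quat" where "qj = Quat 0 0 1 0"
definition qk :: "'a::comm_ring_1 quat" where "qk = Quat 0 0 0 1"

lemma quat_units:
  "qi * qi = (- 1 :: 'a::comm_ring_1 quat)"
  "qj * qj = (- 1 :: 'a::comm_ring_1 quat)"
  "qk * qk = (- 1 :: 'a::comm_ring_1 quat)"
  "qi * qj * qk = (- 1 :: 'a::comm_ring_1 quat)"
  by (simp_all add: qi_def qj_def qk_def quat_ops)

definition qscale :: "'a::comm_ring_1 \<Rightarrow> 'a quat \<Rightarrow> 'a quat"  (infixr \<open>*\<^sub>q\<close> 75)
  where "c *\<^sub>q x = Quat (c * qre x) (c * qim1 x) (c * qim2 x) (c * qim3 x)"

definition qdivide :: "'a::field quat \<Rightarrow> 'a \<Rightarrow> 'a quat"  (infixl \<open>'/\<^sub>q\<close> 70)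
  where "x /\<^sub>q c = inverse c *\<^sub>q x"

lemma qscale_eq_mult: "c *\<^sub>q x = Quat c 0 0 0 * x" "c *\<^sub>q x = x * Quat c 0 0 0"
  by (simp_all add: qscale_def quat_ops mult.commute)

lemma Quat_eq_units: "Quat s t u v = s *\<^sub>q 1 + t *\<^sub>q qi + u *\<^sub>q qj + v *\<^sub>q qk"
  by (simp add: qscale_def quat_ops qi_def qj_def qk_def)


section \<open>Dual numbers over a (not necessarily commutative) ring\<close>

text \<open>\<open>Dual p p'\<close> is $p + \varepsilon p'$.\<close>

datatype 'a dual = Dual (std_part: 'a) (dual_part: 'a)

instantiation dual :: (ring_1) ring_1
begin

definition "0 = Dual 0 0"

definition "1 = Dual 1 0"

definition "x + y = Dual (std_part x + std_part y) (dual_part x + dual_part y)"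

definition "- x = Dual (- std_part x) (- dual_part x)"

definition "x - y = Dual (std_part x - std_part y) (dual_part x - dual_part y)"

definition "x * y = Dual (std_part x * std_part y)
  (dual_part x * std_part y + std_part x * dual_part y)"

lemmas dual_ops = zero_dual_def one_dual_def plus_dual_def uminus_dual_def minus_dual_def
  times_dual_def

instance
  by standard (simp_all add: dual_ops algebra_simps)

end

definition eps :: "'a::ring_1 dual"  (\<open>\<epsilon>\<close>)
  where "\<epsilon> = Dual 0 1"

definition to_dual :: "'a::ring_1 \<Rightarrow> 'a dual"
  where "to_dual x = Dual x 0"

lemma eps_nonzero: "\<epsilon> \<noteq> (0 :: 'a::ring_1 dual)"
  and eps_square: "\<epsilon> * \<epsilon> = (0 :: 'a::ring_1 dual)"
  and eps_central: "\<epsilon> * x = x * (\<epsilon> :: 'a::ring_1 dual)"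
  and Dual_eq_eps: "Dual p p' = to_dual p + \<epsilon> * to_dual p'"
  by (simp_all add: eps_def to_dual_def dual_ops)


section \<open>Extending the scalars of dual quaternions from the reals to the complex numbers\<close>

definition complexify :: "real quat dual \<Rightarrow> complex quat dual"
  where "complexify = map_dual (map_quat complex_of_real)"

lemma complexify_hom:
  "complexify 0 = 0"
  "complexify 1 = 1"
  "complexify (x + y) = complexify x + complexify y"
  "complexify (x - y) = complexify x - complexify y"
  "complexify (- x) = - complexify x"
  "complexify (x * y) = complexify x * complexify y"
  by (cases x; cases y; simp add: complexify_def dual_ops quat_ops quat.map_sel)+

lemma inj_complexify: "inj complexify"
  unfolding complexify_def by (intro dual.inj_map quat.inj_map inj_of_real)


section \<open>Bi-periodic Fibonacci numbers, quaternions and dual quaternions\<close>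

fun bifib :: "real \<Rightarrow> real \<Rightarrow> nat \<Rightarrow> real" where
  "bifib a b 0 = 0"
| "bifib a b (Suc 0) = 1"
| "bifib a b (Suc (Suc n)) =
    (if even (Suc (Suc n)) then a else b) * bifib a b (Suc n) + bifib a b n"

definition bifib_quat :: "real \<Rightarrow> real \<Rightarrow> nat \<Rightarrow> real quat"
  where "bifib_quat a b n =
    Quat (bifib a b n) (bifib a b (n + 1)) (bifib a b (n + 2)) (bifib a b (n + 3))"

definition bifib_dual_quat :: "real \<Rightarrow> real \<Rightarrow> nat \<Rightarrow> real quat dual"
  where "bifib_dual_quat a b n = Dual (bifib_quat a b n) (bifib_quat a b (n + 1))"

text \<open>$x^{\ast}$ and $x^{\ast\ast}$, to be used with $x = \alpha$ and $x = \beta$.\<close>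

definition star :: "real \<Rightarrow> real \<Rightarrow> complex \<Rightarrow> complex quat"
  where "star a b x = Quat (of_real a) x
    (of_real (a / (a * b)) * x ^ 2) (of_real (1 / (a * b)) * x ^ 3)"

definition star_star :: "real \<Rightarrow> real \<Rightarrow> complex \<Rightarrow> complex quat"
  where "star_star a b x = Quat 1 (of_real (a / (a * b)) * x)
    (of_real (1 / (a * b)) * x ^ 2) (of_real (a / (a * b) ^ 2) * x ^ 3)"

end

theory Submission imports Defs begin

text \<open>Put \<open>u = \<alpha> + 1\<close> and \<open>v = \<beta> + 1\<close>. Since \<open>\<alpha>\<^sup>2 = a b u\<close> and \<open>\<beta>\<^sup>2 = a b v\<close>,
  the Binet formulas read \<open>(\<alpha> - \<beta>) Q\<^bsub>2n\<^esub> = u\<^sup>n \<alpha>\<^sup>* - v\<^sup>n \<beta>\<^sup>*\<close> and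
  \<open>(\<alpha> - \<beta>) Q\<^bsub>2n+1\<^esub> = u\<^sup>n \<alpha> \<alpha>\<^sup>*\<^sup>* - v\<^sup>n \<beta> \<beta>\<^sup>*\<^sup>*\<close>. As \<open>u v = 1\<close>, in a Cassini-type difference
  \<open>R\<^sub>n S\<^bsub>n+2\<^esub> - R\<^bsub>n+1\<^esub> S\<^bsub>n+1\<^esub>\<close> of two such sequences the diagonal products cancel and the mixed ones
  get the constant coefficients \<open>1 - v\<^sup>2\<close> and \<open>1 - u\<^sup>2\<close>. Each of the standard and dual
  parts of the two identities is a sum of such differences.\<close>

section \<open>Scalar multiples of quaternions and Cassini differences\<close>

lemma qscale_simps:
  fixes x y :: "'a::comm_ring_1 quat"
  shows "c *\<^sub>q (x + y) = c *\<^sub>q x + c *\<^sub>q y"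
    and "c *\<^sub>q (x - y) = c *\<^sub>q x - c *\<^sub>q y"
    and "c *\<^sub>q (- x) = - (c *\<^sub>q x)"
    and "(- c) *\<^sub>q x = - (c *\<^sub>q x)"
    and "c *\<^sub>q d *\<^sub>q x = (c * d) *\<^sub>q x"
    and "(c *\<^sub>q x) * y = c *\<^sub>q (x * y)"
    and "x * (c *\<^sub>q y) = c *\<^sub>q (x * y)"
    and "(c *\<^sub>q x) * (d *\<^sub>q y) = (c * d) *\<^sub>q (x * y)"
  by (simp_all add: qscale_def quat_ops algebra_simps)

lemma qscale_one [simp]: "1 *\<^sub>q x = x"
  by (simp add: qscale_def)

text \<open>Four independent coefficients let one identity serve products of equal and of mixed
  parity. The surviving \<open>X * W\<close> term has scalar
  \<open>u ^ (n + 1) * v ^ (n + 1) - u ^ n * v ^ (n + 2)\<close>, which is \<open>1 - v ^ 2\<close>;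
  factors stay in order because quaternions do not commute.\<close>

lemma qscale_cassini:
  fixes X Y Z W :: "'a::comm_ring_1 quat"
  assumes "u * v = 1"
  shows "(u ^ n *\<^sub>q X - v ^ n *\<^sub>q Y) * (u ^ (n + 2) *\<^sub>q Z - v ^ (n + 2) *\<^sub>q W)
       - (u ^ (n + 1) *\<^sub>q X - v ^ (n + 1) *\<^sub>q Y) * (u ^ (n + 1) *\<^sub>q Z - v ^ (n + 1) *\<^sub>q W)
       = (1 - v ^ 2) *\<^sub>q (X * W) + (1 - u ^ 2) *\<^sub>q (Y * Z)"
proof -
  have uv: "u ^ n * v ^ n = 1"
    using assms by (metis power_mult_distrib power_one)
  have coeffs: "u ^ n * u ^ (n + 2) = u ^ (n + 1) * u ^ (n + 1)"
    "v ^ n * v ^ (n + 2) = v ^ (n + 1) * v ^ (n + 1)"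
    "u ^ n * v ^ (n + 2) = v ^ 2" "v ^ n * u ^ (n + 2) = u ^ 2"
    "u ^ (n + 1) * v ^ (n + 1) = 1" "v ^ (n + 1) * u ^ (n + 1) = 1"
  proof -
    show "u ^ n * v ^ (n + 2) = v ^ 2"
      using uv by (simp only: power_add mult_1 flip: mult.assoc)
    show "v ^ n * u ^ (n + 2) = u ^ 2"
      using uv by (simp only: power_add mult_1 mult.commute[of "v ^ n" "u ^ n"] flip: mult.assoc)
    show "u ^ (n + 1) * v ^ (n + 1) = 1" "v ^ (n + 1) * u ^ (n + 1) = 1"
      using assms by (metis power_mult_distrib power_one mult.commute)+
  qed (simp_all add: power2_eq_square mult_ac)
  show ?thesis
    unfolding left_diff_distrib right_diff_distrib qscale_simps(8) coeffs
    by (simp add: qscale_def quat_ops algebra_simps)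
qed

section \<open>Roots of the quadratic and Binet formulas\<close>

lemma vieta_identities:
  fixes \<alpha> \<beta> p :: complex
  assumes sum: "\<alpha> + \<beta> = p" and prod: "\<alpha> * \<beta> = - p"
  shows "\<alpha> ^ 2 = p * (\<alpha> + 1)" "\<beta> ^ 2 = p * (\<beta> + 1)"
    and "(\<alpha> + 1) * (\<beta> + 1) = 1"
    and "(\<alpha> + 1) * \<beta> = - \<alpha>" "(\<beta> + 1) * \<alpha> = - \<beta>"
proof -
  \<comment> \<open>With \<open>p\<close> eliminated, all five claims follow from this relation. The
    last two claims later turn a scalar such as \<open>u * \<beta>\<close> into a single negated
    root.\<close>
  have prod': "\<alpha> * \<beta> = - (\<alpha> + \<beta>)" using sum prod by simp
  show "\<alpha> ^ 2 = p * (\<alpha> + 1)" "\<beta> ^ 2 = p * (\<beta> + 1)"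
    unfolding sum[symmetric] using prod'
    by (simp_all add: distrib_left distrib_right power2_eq_square mult.commute[of \<beta> \<alpha>])
  show "(\<alpha> + 1) * (\<beta> + 1) = 1"
    and "(\<alpha> + 1) * \<beta> = - \<alpha>" "(\<beta> + 1) * \<alpha> = - \<beta>"
    using prod' by (simp_all add: distrib_left distrib_right mult.commute[of \<beta> \<alpha>])
qed

text \<open>Both parities go through one induction because each step of the recurrence uses the
  other parity. The factor \<alpha> - \<beta> stays on the left to keep division out.\<close>

lemma bifib_binet:
  fixes \<alpha> \<beta> :: complex
  assumes sum: "\<alpha> + \<beta> = of_real (a * b)" and prod: "\<alpha> * \<beta> = - of_real (a * b)"
  shows "(\<alpha> - \<beta>) * of_real (bifib a b (2 * n)) = of_real a * ((\<alpha> + 1) ^ n - (\<beta> + 1) ^ n)"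
    and "(\<alpha> - \<beta>) * of_real (bifib a b (2 * n + 1)) = \<alpha> * (\<alpha> + 1) ^ n - \<beta> * (\<beta> + 1) ^ n"
proof (induction n)
  case 0
  show "(\<alpha> - \<beta>) * of_real (bifib a b (2 * 0)) = of_real a * ((\<alpha> + 1) ^ 0 - (\<beta> + 1) ^ 0)"
    and "(\<alpha> - \<beta>) * of_real (bifib a b (2 * 0 + 1)) = \<alpha> * (\<alpha> + 1) ^ 0 - \<beta> * (\<beta> + 1) ^ 0"
    by simp_all
next
  case (Suc n)
  define E D where "E = complex_of_real (bifib a b (2 * n))"
    and "D = complex_of_real (bifib a b (2 * n + 1))"
  have IH: "(\<alpha> - \<beta>) * E = of_real a * ((\<alpha> + 1) ^ n - (\<beta> + 1) ^ n)"
    "(\<alpha> - \<beta>) * D = \<alpha> * (\<alpha> + 1) ^ n - \<beta> * (\<beta> + 1) ^ n"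
    using Suc by (simp_all add: E_def D_def)
  have step: "complex_of_real (bifib a b (2 * Suc n)) = of_real a * D + E"
    "complex_of_real (bifib a b (2 * Suc n + 1)) = of_real b * (of_real a * D + E) + D"
    by (simp_all add: E_def D_def)
  note roots = vieta_identities(1,2)[OF sum prod]
  show even: "(\<alpha> - \<beta>) * of_real (bifib a b (2 * Suc n))
      = of_real a * ((\<alpha> + 1) ^ Suc n - (\<beta> + 1) ^ Suc n)"
  proof -
    have "(\<alpha> - \<beta>) * (of_real a * D + E) = of_real a * ((\<alpha> - \<beta>) * D) + (\<alpha> - \<beta>) * E"
      by algebra
    then show ?thesis
      unfolding step power_Suc IH by (simp add: algebra_simps)
  qed
  have "(\<alpha> - \<beta>) * (of_real b * (of_real a * D + E) + D)
      = of_real b * ((\<alpha> - \<beta>) * (of_real a * D + E)) + (\<alpha> - \<beta>) * D"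
    by algebra
  also have "\<dots> = of_real (a * b) * ((\<alpha> + 1) * (\<alpha> + 1) ^ n - (\<beta> + 1) * (\<beta> + 1) ^ n)
      + (\<alpha> * (\<alpha> + 1) ^ n - \<beta> * (\<beta> + 1) ^ n)"
    using even unfolding step IH by simp
  also have "\<dots> = \<alpha> * (\<alpha> + 1) ^ Suc n - \<beta> * (\<beta> + 1) ^ Suc n"
  proof -
    \<comment> \<open>At a root \<open>x ^ 2\<close> is \<open>a * b * (x + 1)\<close>, so the first
      summand is exactly the \<open>a * b\<close> term of the recurrence.\<close>
    have expand: "x * (x + 1) ^ Suc n = x ^ 2 * (x + 1) ^ n + x * (x + 1) ^ n" for x :: complex
      by (simp add: algebra_simps power2_eq_square)
    show ?thesis
      unfolding expand roots by (simp add: algebra_simps)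
  qed
  finally show "(\<alpha> - \<beta>) * of_real (bifib a b (2 * Suc n + 1))
      = \<alpha> * (\<alpha> + 1) ^ Suc n - \<beta> * (\<beta> + 1) ^ Suc n"
    unfolding step .
qed

text \<open>The root equation lowers the powers of \<open>x\<close>, and the coordinates become the
  Binet coefficients of four consecutive Fibonacci numbers. As \<open>star_star\<close> starts with
  1, it needs the factor \<open>x\<close> to match an odd starting index.\<close>

lemma star_root:
  fixes x :: complex
  assumes "a \<noteq> 0" "b \<noteq> 0" and root: "x ^ 2 = of_real (a * b) * (x + 1)"
  shows "star a b x = Quat (of_real a) x (of_real a * (x + 1)) (x * (x + 1))"
    and "x *\<^sub>q star_star a b x
      = Quat x (of_real a * (x + 1)) (x * (x + 1)) (of_real a * (x + 1) ^ 2)"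
proof -
  have p: "complex_of_real (a * b) \<noteq> 0" using assms by simp
  have "x ^ 3 = of_real (a * b) * (x * (x + 1))" "x ^ 4 = of_real (a * b) ^ 2 * (x + 1) ^ 2"
    using root by algebra+
  then have pow: "x ^ 2 / of_real (a * b) = x + 1" "x ^ 3 / of_real (a * b) = x * (x + 1)"
      "x ^ 4 / of_real (a * b) ^ 2 = (x + 1) ^ 2"
    using root p by (simp_all del: of_real_mult)
  have div: "complex_of_real (s / t) * y = of_real s * (y / of_real t)" for s t y
    by simp
  show "star a b x = Quat (of_real a) x (of_real a * (x + 1)) (x * (x + 1))"
    unfolding star_def div pow by simp
  have "x *\<^sub>q star_star a b x = Quat x (of_real a * (x ^ 2 / of_real (a * b)))
      (x ^ 3 / of_real (a * b)) (of_real a * (x ^ 4 / of_real (a * b) ^ 2))"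
    unfolding star_star_def qscale_def
    by (simp add: power2_eq_square power3_eq_cube power4_eq_xxxx)
  then show "x *\<^sub>q star_star a b x
      = Quat x (of_real a * (x + 1)) (x * (x + 1)) (of_real a * (x + 1) ^ 2)"
    unfolding pow .
qed

lemma bifib_quat_binet:
  fixes \<alpha> \<beta> :: complex
  assumes "a \<noteq> 0" "b \<noteq> 0"
    and sum: "\<alpha> + \<beta> = of_real (a * b)" and prod: "\<alpha> * \<beta> = - of_real (a * b)"
  shows "(\<alpha> - \<beta>) *\<^sub>q map_quat of_real (bifib_quat a b (2 * n))
      = (\<alpha> + 1) ^ n *\<^sub>q star a b \<alpha> - (\<beta> + 1) ^ n *\<^sub>q star a b \<beta>"
    and "(\<alpha> - \<beta>) *\<^sub>q map_quat of_real (bifib_quat a b (2 * n + 1))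
      = (\<alpha> + 1) ^ n *\<^sub>q \<alpha> *\<^sub>q star_star a b \<alpha> - (\<beta> + 1) ^ n *\<^sub>q \<beta> *\<^sub>q star_star a b \<beta>"
proof -
  note roots = vieta_identities(1,2)[OF sum prod]
  note binet = bifib_binet[OF sum prod]
  have idx: "2 * n + 2 = 2 * (n + 1)" "2 * n + 3 = 2 * (n + 1) + 1"
    "2 * n + 1 + 1 = 2 * (n + 1)" "2 * n + 1 + 2 = 2 * (n + 1) + 1" "2 * n + 1 + 3 = 2 * (n + 2)"
    by simp_all
  show "(\<alpha> - \<beta>) *\<^sub>q map_quat of_real (bifib_quat a b (2 * n))
      = (\<alpha> + 1) ^ n *\<^sub>q star a b \<alpha> - (\<beta> + 1) ^ n *\<^sub>q star a b \<beta>"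
    unfolding star_root(1)[OF assms(1,2) roots(1)] star_root(1)[OF assms(1,2) roots(2)]
      bifib_quat_def idx quat.map qscale_def quat.sel binet minus_quat_def
    by (simp add: algebra_simps)
  show "(\<alpha> - \<beta>) *\<^sub>q map_quat of_real (bifib_quat a b (2 * n + 1))
      = (\<alpha> + 1) ^ n *\<^sub>q \<alpha> *\<^sub>q star_star a b \<alpha> - (\<beta> + 1) ^ n *\<^sub>q \<beta> *\<^sub>q star_star a b \<beta>"
    \<comment> \<open>These equations match a scaled quaternion, so they must act before
      \<open>qscale_def\<close> dissolves the scaling.\<close>
    unfolding star_root(2)[OF assms(1,2) roots(1)] star_root(2)[OF assms(1,2) roots(2)]
    unfolding
      bifib_quat_def idx quat.map qscale_def quat.sel binet minus_quat_def
    by (simp add: algebra_simps power2_eq_square)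
qed

text \<open>The set equation alone would allow \<alpha> = \<beta>. The reflection of \<alpha> to
  \<open>p - \<alpha>\<close> gives a root again; if it fixed \<alpha>, the discriminant
  \<open>p * (p + 4)\<close> would vanish. Hence \<open>p - \<alpha>\<close> is the other root
  \<beta>.\<close>

lemma quadratic_roots_vieta:
  fixes p \<alpha> \<beta> :: "'a::field_char_0"
  assumes roots: "{x. x ^ 2 - p * x - p = 0} = {\<alpha>, \<beta>}" and "p \<noteq> 0" "p \<noteq> - 4"
  shows "\<alpha> + \<beta> = p" "\<alpha> * \<beta> = - p" "\<alpha> \<noteq> \<beta>"
proof -
  have \<alpha>: "\<alpha> ^ 2 - p * \<alpha> - p = 0" using roots by blast
  then have "(p - \<alpha>) ^ 2 - p * (p - \<alpha>) - p = 0"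
    by algebra
  then have "p - \<alpha> \<in> {\<alpha>, \<beta>}" using roots by blast
  moreover have ne: "p - \<alpha> \<noteq> \<alpha>"
  proof
    assume "p - \<alpha> = \<alpha>"
    then have "p = 2 * \<alpha>" by (simp add: algebra_simps)
    then have "p * (p + 4) = - 4 * (\<alpha> ^ 2 - p * \<alpha> - p)"
      by (simp add: algebra_simps power2_eq_square)
    then have "p * (p + 4) = 0" using \<alpha> by simp
    then show False using assms(2,3) by (auto simp: add_eq_0_iff2)
  qed
  ultimately show sum: "\<alpha> + \<beta> = p" by auto
  show "\<alpha> * \<beta> = - p"
  proof -
    have "\<beta> = p - \<alpha>" using sum by (simp add: algebra_simps)
    then show ?thesis using \<alpha> by algebra
  qed
  show "\<alpha> \<noteq> \<beta>" using sum ne by auto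
qed

section \<open>The identities for odd and even indices\<close>

theorem theorem3p4:
  fixes a b :: real and \<alpha> \<beta> :: complex and m :: nat
  assumes "a \<noteq> 0" and "b \<noteq> 0" and "a * b \<noteq> - 4"
    and roots: "{x :: complex. x ^ 2 - of_real (a * b) * x - of_real (a * b) = 0} = {\<alpha>, \<beta>}"
    and "m \<ge> 1"
  shows
    "let Q = bifib_dual_quat a b;
         ab = complex_of_real (a * b);
         \<alpha>s = star a b \<alpha>; \<beta>s = star a b \<beta>;
         \<alpha>ss = star_star a b \<alpha>; \<beta>ss = star_star a b \<beta>
     in
       complexify (Q (2 * m - 1) * Q (2 * m + 3) - Q (2 * m + 1) ^ 2) =
         - to_dual
             (((ab ^ 2 - \<beta> ^ 4) *\<^sub>q (\<alpha>ss * \<beta>ss) + (ab ^ 2 - \<alpha> ^ 4) *\<^sub>q (\<beta>ss * \<alpha>ss))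
               /\<^sub>q (ab * (\<alpha> - \<beta>) ^ 2))
         - \<epsilon> * to_dual
             ((\<alpha> *\<^sub>q ((ab ^ 2 - \<beta> ^ 4) *\<^sub>q (\<alpha>s * \<beta>ss) + (ab ^ 2 - \<alpha> ^ 4) *\<^sub>q (\<beta>ss * \<alpha>s)))
               /\<^sub>q (ab ^ 2 * (\<alpha> - \<beta>) ^ 2)
             + (\<beta> *\<^sub>q ((ab ^ 2 - \<alpha> ^ 4) *\<^sub>q (\<beta>s * \<alpha>ss) + (ab ^ 2 - \<beta> ^ 4) *\<^sub>q (\<alpha>ss * \<beta>s)))
               /\<^sub>q (ab ^ 2 * (\<alpha> - \<beta>) ^ 2))
     \<and>
       complexify (Q (2 * m - 2) * Q (2 * m + 2) - Q (2 * m) ^ 2) =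
         to_dual
             (((ab ^ 2 - \<beta> ^ 4) *\<^sub>q (\<alpha>s * \<beta>s) + (ab ^ 2 - \<alpha> ^ 4) *\<^sub>q (\<beta>s * \<alpha>s))
               /\<^sub>q (ab ^ 2 * (\<alpha> - \<beta>) ^ 2))
         + \<epsilon> * to_dual
             (((ab ^ 2 - \<beta> ^ 4) *\<^sub>q (\<alpha> *\<^sub>q (\<alpha>ss * \<beta>s) + \<beta> *\<^sub>q (\<alpha>s * \<beta>ss)))
               /\<^sub>q (ab ^ 2 * (\<alpha> - \<beta>) ^ 2)
             + ((ab ^ 2 - \<alpha> ^ 4) *\<^sub>q (\<alpha> *\<^sub>q (\<beta>s * \<alpha>ss) + \<beta> *\<^sub>q (\<beta>ss * \<alpha>s)))
               /\<^sub>q (ab ^ 2 * (\<alpha> - \<beta>) ^ 2))"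
proof -
  define p where "p = complex_of_real (a * b)"
  have p: "p \<noteq> 0" "p \<noteq> - 4"
  proof -
    show "p \<noteq> 0" using assms(1,2) by (simp add: p_def)
    have "p \<noteq> complex_of_real (- 4)" unfolding p_def of_real_eq_iff by (rule assms(3))
    then show "p \<noteq> - 4" by simp
  qed
  note vieta = quadratic_roots_vieta[OF roots[folded p_def] p]
  define u v d where "u = \<alpha> + 1" and "v = \<beta> + 1" and "d = \<alpha> - \<beta>"
  have d: "d \<noteq> 0" using vieta by (simp add: d_def)
  note ids = vieta_identities[OF vieta(1,2), folded u_def v_def]
  \<comment> \<open>Source of the fourth powers in the statement: \<open>p * u\<close> is the square
    of \<alpha>, and \<open>p * v\<close> that of \<beta>.\<close>
  have pu: "p ^ 2 * (1 - u ^ 2) = p ^ 2 - \<alpha> ^ 4" and pv: "p ^ 2 * (1 - v ^ 2) = p ^ 2 - \<beta> ^ 4"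
    using ids(1,2) by algebra+

  define q where "q k = map_quat complex_of_real (bifib_quat a b k)" for k
  define X Y Z W where "X = star a b \<alpha>" and "Y = star a b \<beta>"
    and "Z = star_star a b \<alpha>" and "W = star_star a b \<beta>"
  note binet = bifib_quat_binet[OF assms(1,2) vieta(1,2)[unfolded p_def],
      folded q_def d_def u_def v_def X_def Y_def Z_def W_def]
  have even: "\<And>k. d *\<^sub>q q (2 * k) = u ^ k *\<^sub>q X - v ^ k *\<^sub>q Y"
    and odd: "\<And>k. d *\<^sub>q q (2 * k + 1) = u ^ k *\<^sub>q \<alpha> *\<^sub>q Z - v ^ k *\<^sub>q \<beta> *\<^sub>q W"
    by (fact binet)+
  \<comment> \<open>The dual part at index \<open>2 * k + 1\<close> is \<open>q (2 * k + 2)\<close>;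
    read as a sequence in \<open>k\<close>, it has coefficients \<open>u *\<^sub>q X\<close> and
    \<open>v *\<^sub>q Y\<close>.\<close>
  have shifted: "\<And>k. d *\<^sub>q q (2 * k + 2) = u ^ k *\<^sub>q u *\<^sub>q X - v ^ k *\<^sub>q v *\<^sub>q Y"
    using even[of "Suc k" for k] by (simp add: qscale_simps mult_ac)
  \<comment> \<open>Stated for arbitrary sequences of Binet shape, so that all six differences below
    are instances. Scaling by \<open>d ^ 2\<close> clears the Binet denominators, and
    \<open>p ^ 2\<close> makes \<open>pu\<close> and \<open>pv\<close> applicable.\<close>
  have cassini: "f k * g (k + 2) - f (k + 1) * g (k + 1)
      = inverse (p ^ 2 * d ^ 2) *\<^sub>q ((p ^ 2 - \<beta> ^ 4) *\<^sub>q (R * S') + (p ^ 2 - \<alpha> ^ 4) *\<^sub>q (R' * S))"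
    if f: "\<And>k. d *\<^sub>q f k = u ^ k *\<^sub>q R - v ^ k *\<^sub>q R'"
      and g: "\<And>k. d *\<^sub>q g k = u ^ k *\<^sub>q S - v ^ k *\<^sub>q S'"
    for f g R R' S S' k
  proof -
    let ?D = "f k * g (k + 2) - f (k + 1) * g (k + 1)"
    have "d ^ 2 *\<^sub>q ?D = (d *\<^sub>q f k) * (d *\<^sub>q g (k + 2)) - (d *\<^sub>q f (k + 1)) * (d *\<^sub>q g (k + 1))"
      by (simp add: qscale_simps power2_eq_square)
    also have "\<dots> = (1 - v ^ 2) *\<^sub>q (R * S') + (1 - u ^ 2) *\<^sub>q (R' * S)"
      unfolding f g by (rule qscale_cassini[OF ids(3)])
    finally have "p ^ 2 *\<^sub>q d ^ 2 *\<^sub>q ?D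
        = (p ^ 2 - \<beta> ^ 4) *\<^sub>q (R * S') + (p ^ 2 - \<alpha> ^ 4) *\<^sub>q (R' * S)"
      by (simp only: qscale_simps pu pv)
    moreover have "?D = inverse (p ^ 2 * d ^ 2) *\<^sub>q p ^ 2 *\<^sub>q d ^ 2 *\<^sub>q ?D"
    proof -
      have "inverse (p ^ 2 * d ^ 2) * (p ^ 2 * d ^ 2) = 1" using p d by (intro left_inverse) simp
      then show ?thesis by (simp only: qscale_simps(5) mult.assoc qscale_one)
    qed
    ultimately show ?thesis by simp
  qed

  \<comment> \<open>Writing \<open>m\<close> as a successor removes the truncated subtraction from
    the indices.\<close>
  obtain n where m: "m = Suc n" using \<open>m \<ge> 1\<close> by (cases m) auto
  have idx: "2 * m - 1 = 2 * n + 1" "2 * m + 3 = 2 * (n + 2) + 1" "2 * m + 1 = 2 * (n + 1) + 1"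
    "2 * m - 2 = 2 * n" "2 * m + 2 = 2 * (n + 2)" "2 * m = 2 * (n + 1)"
    by (simp_all add: m)
  have Q: "complexify (bifib_dual_quat a b k) = Dual (q k) (q (k + 1))" for k
    by (simp add: complexify_def bifib_dual_quat_def q_def)
  define c where "c = inverse (p ^ 2 * d ^ 2)"
  define A B where "A = p ^ 2 - \<alpha> ^ 4" and "B = p ^ 2 - \<beta> ^ 4"
  note cassini = cassini[folded c_def A_def B_def]
  \<comment> \<open>In the odd standard part the scalar \<alpha>\<beta> = -p cancels one factor
    \<open>p\<close> of the denominator and gives the minus sign.\<close>
  have cp: "inverse (p * d ^ 2) = c * p"
    using p by (simp add: c_def field_simps power2_eq_square)
  have "complexify (bifib_dual_quat a b (2 * m - 1) * bifib_dual_quat a b (2 * m + 3)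
        - bifib_dual_quat a b (2 * m + 1) ^ 2)
      = Dual (q (2 * n + 1) * q (2 * (n + 2) + 1) - q (2 * (n + 1) + 1) * q (2 * (n + 1) + 1))
        ((q (2 * n + 2) * q (2 * (n + 2) + 1) - q (2 * (n + 1) + 2) * q (2 * (n + 1) + 1))
        + (q (2 * n + 1) * q (2 * (n + 2) + 2) - q (2 * (n + 1) + 1) * q (2 * (n + 1) + 2)))"
    unfolding power2_eq_square complexify_hom idx Q by (simp add: dual_ops eval_nat_numeral)
  also have "\<dots> = Dual
      (c *\<^sub>q (B *\<^sub>q ((\<alpha> *\<^sub>q Z) * (\<beta> *\<^sub>q W)) + A *\<^sub>q ((\<beta> *\<^sub>q W) * (\<alpha> *\<^sub>q Z))))
      (c *\<^sub>q (B *\<^sub>q ((u *\<^sub>q X) * (\<beta> *\<^sub>q W)) + A *\<^sub>q ((v *\<^sub>q Y) * (\<alpha> *\<^sub>q Z)))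
        + c *\<^sub>q (B *\<^sub>q ((\<alpha> *\<^sub>q Z) * (v *\<^sub>q Y)) + A *\<^sub>q ((\<beta> *\<^sub>q W) * (u *\<^sub>q X))))"
    using cassini[of "\<lambda>k. q (2 * k + 1)", OF odd odd, of n]
      cassini[of "\<lambda>k. q (2 * k + 2)" _ _ "\<lambda>k. q (2 * k + 1)", OF shifted odd, of n]
      cassini[of "\<lambda>k. q (2 * k + 1)" _ _ "\<lambda>k. q (2 * k + 2)", OF odd shifted, of n]
    by simp
  also have "\<dots> = Dual
      (- ((B *\<^sub>q (Z * W) + A *\<^sub>q (W * Z)) /\<^sub>q (p * d ^ 2)))
      (- ((\<alpha> *\<^sub>q (B *\<^sub>q (X * W) + A *\<^sub>q (W * X))) /\<^sub>q (p ^ 2 * d ^ 2)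
        + (\<beta> *\<^sub>q (A *\<^sub>q (Y * Z) + B *\<^sub>q (Z * Y))) /\<^sub>q (p ^ 2 * d ^ 2)))"
  proof -
    have "\<alpha> * \<beta> = - p" "\<beta> * \<alpha> = - p" "\<beta> * u = - \<alpha>" "\<alpha> * v = - \<beta>"
      using vieta(2) ids(4,5) by (simp_all add: mult.commute)
    then show ?thesis
      unfolding qdivide_def cp c_def[symmetric]
      by (simp add: qscale_simps ac_simps)
  qed
  finally have 1: "complexify (bifib_dual_quat a b (2 * m - 1) * bifib_dual_quat a b (2 * m + 3)
        - bifib_dual_quat a b (2 * m + 1) ^ 2) = \<dots>" .

  have "complexify (bifib_dual_quat a b (2 * m - 2) * bifib_dual_quat a b (2 * m + 2)
        - bifib_dual_quat a b (2 * m) ^ 2)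
      = Dual (q (2 * n) * q (2 * (n + 2)) - q (2 * (n + 1)) * q (2 * (n + 1)))
        ((q (2 * n + 1) * q (2 * (n + 2)) - q (2 * (n + 1) + 1) * q (2 * (n + 1)))
        + (q (2 * n) * q (2 * (n + 2) + 1) - q (2 * (n + 1)) * q (2 * (n + 1) + 1)))"
    unfolding power2_eq_square complexify_hom idx Q by (simp add: dual_ops eval_nat_numeral)
  \<comment> \<open>For even indices the dual parts are the sequence \<open>q (2 * k + 1)\<close>
    itself, so \<open>odd\<close> replaces \<open>shifted\<close> and no sign appears.\<close>
  also have "\<dots> = Dual
      (c *\<^sub>q (B *\<^sub>q (X * Y) + A *\<^sub>q (Y * X)))
      (c *\<^sub>q (B *\<^sub>q ((\<alpha> *\<^sub>q Z) * Y) + A *\<^sub>q ((\<beta> *\<^sub>q W) * X))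
        + c *\<^sub>q (B *\<^sub>q (X * (\<beta> *\<^sub>q W)) + A *\<^sub>q (Y * (\<alpha> *\<^sub>q Z))))"
    using cassini[of "\<lambda>k. q (2 * k)", OF even even, of n]
      cassini[of "\<lambda>k. q (2 * k + 1)" _ _ "\<lambda>k. q (2 * k)", OF odd even, of n]
      cassini[of "\<lambda>k. q (2 * k)" _ _ "\<lambda>k. q (2 * k + 1)", OF even odd, of n]
    by simp
  also have "\<dots> = Dual
      ((B *\<^sub>q (X * Y) + A *\<^sub>q (Y * X)) /\<^sub>q (p ^ 2 * d ^ 2))
      ((B *\<^sub>q (\<alpha> *\<^sub>q (Z * Y) + \<beta> *\<^sub>q (X * W))) /\<^sub>q (p ^ 2 * d ^ 2)
        + (A *\<^sub>q (\<alpha> *\<^sub>q (Y * Z) + \<beta> *\<^sub>q (W * X))) /\<^sub>q (p ^ 2 * d ^ 2))"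
    unfolding qdivide_def c_def[symmetric] by (simp add: qscale_simps mult_ac add_ac)
  finally have 2: "complexify (bifib_dual_quat a b (2 * m - 2) * bifib_dual_quat a b (2 * m + 2)
        - bifib_dual_quat a b (2 * m) ^ 2) = \<dots>" .

  have neg: "- to_dual x - \<epsilon> * to_dual y = Dual (- x) (- y)" for x y :: "complex quat"
    by (simp add: eps_def to_dual_def dual_ops)
  show ?thesis
    unfolding Let_def neg Dual_eq_eps[symmetric]
      p_def[symmetric] d_def[symmetric] X_def[symmetric] Y_def[symmetric]
      Z_def[symmetric] W_def[symmetric] A_def[symmetric] B_def[symmetric]
    by (intro conjI 1 2)
qed

end
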